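(* Let $f:\mathbb{R}^d\to\mathbb{R}$, $\mathcal M$, $\alpha>0$, $\mathcal U_\alpha$, $\pi$ and $\mu>0$ satisfy the standing assumptions (1)-(4) listed in the context. Assume in addition that (i) for every $R>\inf f$ there exists $L_R>0$ such that $\nabla f$ is Lipschitz-continuous with Lipschitz constant $L_R$ on the set $\{x\in\mathbb{R}^d: f(x)<R\}$, and (ii) there exists $\delta>0$ such that, for all $x\in\mathbb{R}^d$, $\|\nabla f(x)\|^2<\delta$ implies $f(x)-\inf f<\frac{\alpha}{2}$. Then for any $x_0\in\mathbb{R}^d$, the solution $x(t)=x_t$ of the heavy ball ODE $$\ddot x+2\sqrt{\mu}\,\dot x=-\nabla f(x),\qquad x(0)=x_0,\qquad \dot x(0)=0,$$ has the following property: there exists $T\ge 0$ such that $x(t)\in\mathcal U_\alpha$ for all $t\ge T$ and $$f(x(t))-\inf f\le \left(\frac{3\alpha}{2}+\mathrm{dist}(x_T,\mathcal M)^2\right)e^{\sqrt{\mu}(T-t)}\qquad\text{for all }t>T.$$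
   Context: Standing assumptions: (1) $f:\mathbb{R}^d\to\mathbb{R}$ is bounded from below, $C^1$-smooth, and its gradient $\nabla f:\mathbb{R}^d\to\mathbb{R}^d$ is locally Lipschitz continuous. We write $\inf f=\inf_{z\in\mathbb{R}^d}f(z)$. (2) The set $\mathcal M=\{x\in\mathbb{R}^d: f(x)=\inf f\}$ of minimizers of $f$ is a non-empty $k$-dimensional $C^2$-submanifold of $\mathbb{R}^d$ with $k<d$. (3) For some $\alpha>0$, with $\mathcal U_\alpha=\{x\in\mathbb{R}^d: f(x)<\inf f+\alpha\}$, for every $x\in\mathcal U_\alpha$ there exists a unique point of $\mathcal M$ closest to $x$; this point is denoted $\pi(x)$, and the closest point projection $\pi:\mathcal U_\alpha\to\mathcal M$ is $C^1$-smooth. (4) $f$ satisfies the $\mu$-strong aiming condition in $\mathcal U_\alpha$ (with $\mu>0$): $$\nabla f(x)\cdot(x-\pi(x))\ge f(x)-f(\pi(x))+\frac{\mu}{2}\|x-\pi(x)\|^2\qquad\text{for all }x\in\mathcal U_\alpha.$$ $\|\cdot\|$ is the Euclidean norm and $\mathrm{dist}(x,\mathcal M)=\inf_{z\in\mathcal M}\|x-z\|$. *)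

theory Defs
  imports "HOL-Analysis.Analysis"
begin

(* Both smoothness notions are meant for open S; the derivative is a map into the
   normed space of bounded linear operators, so its continuity is in operator norm. *)

definition C1_on :: "('a::real_normed_vector \<Rightarrow> 'b::real_normed_vector) \<Rightarrow> 'a set \<Rightarrow> bool"
  where "C1_on f S \<longleftrightarrow>
    (\<exists>f' :: 'a \<Rightarrow> 'a \<Rightarrow>\<^sub>L 'b.
      (\<forall>x\<in>S. (f has_derivative blinfun_apply (f' x)) (at x)) \<and> continuous_on S f')"

definition C2_on :: "('a::real_normed_vector \<Rightarrow> 'b::real_normed_vector) \<Rightarrow> 'a set \<Rightarrow> bool"
  where "C2_on f S \<longleftrightarrow>
    (\<exists>f' :: 'a \<Rightarrow> 'a \<Rightarrow>\<^sub>L 'b.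
      (\<forall>x\<in>S. (f has_derivative blinfun_apply (f' x)) (at x)) \<and> C1_on f' S)"

(* Embedded submanifold without boundary: near each of its points, a C^2 diffeomorphism
   of open sets straightens M to a k-dimensional coordinate subspace. *)
definition C2_submanifold :: "nat \<Rightarrow> (real ^ 'd) set \<Rightarrow> bool"
  where "C2_submanifold k M \<longleftrightarrow>
    (\<forall>p\<in>M. \<exists>(U :: (real ^ 'd) set) (V :: (real ^ 'd) set) \<Phi> \<Psi>. \<exists>I :: 'd set.
      open U \<and> open V \<and> p \<in> U \<and>
      homeomorphism U V \<Phi> \<Psi> \<and> C2_on \<Phi> U \<and> C2_on \<Psi> V \<and>
      card I = k \<and> \<Phi> ` (U \<inter> M) = V \<inter> {y. \<forall>i. i \<notin> I \<longrightarrow> y $ i = 0})"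

definition minimizers :: "('a \<Rightarrow> real) \<Rightarrow> 'a set"
  where "minimizers f = {x. f x = (INF z. f z)}"

definition sublevel :: "('a \<Rightarrow> real) \<Rightarrow> real \<Rightarrow> 'a set"
  where "sublevel f \<alpha> = {x. f x < (INF z. f z) + \<alpha>}"

definition unique_closest_points :: "'a::metric_space set \<Rightarrow> 'a set \<Rightarrow> bool"
  where "unique_closest_points M U \<longleftrightarrow>
    (\<forall>x\<in>U. \<exists>!p. p \<in> M \<and> (\<forall>z\<in>M. dist x p \<le> dist x z))"

(* g plays the role of the gradient of f and proj that of the projection onto its minimizers. *)
definition strong_aiming ::
    "real \<Rightarrow> ('a::real_inner \<Rightarrow> real) \<Rightarrow> ('a \<Rightarrow> 'a) \<Rightarrow> ('a \<Rightarrow> 'a) \<Rightarrow> 'a set \<Rightarrow> bool"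
  where "strong_aiming \<mu> f g proj U \<longleftrightarrow>
    (\<forall>x\<in>U. g x \<bullet> (x - proj x) \<ge> f x - f (proj x) + \<mu> / 2 * norm (x - proj x) ^ 2)"

(* x'' + 2 sqrt \<mu> x' = - g x on [0, \<infinity>), with x 0 = x0 and x' 0 = 0; v is the velocity x'. *)
definition heavy_ball_solution ::
    "real \<Rightarrow> ('a::real_normed_vector \<Rightarrow> 'a) \<Rightarrow> 'a \<Rightarrow> (real \<Rightarrow> 'a) \<Rightarrow> bool"
  where "heavy_ball_solution \<mu> g x0 x \<longleftrightarrow>
    (\<exists>v a. (\<forall>t\<ge>0. (x has_vector_derivative v t) (at t within {0..}) \<and>
                  (v has_vector_derivative a t) (at t within {0..}) \<and>
                  a t + (2 * sqrt \<mu>) *\<^sub>R v t = - g (x t)) \<and>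
           x 0 = x0 \<and> v 0 = 0)"

end

theory Submission
  imports Defs
begin

text \<open>
  Two energies drive the proof. The mechanical energy \<open>E = f(x) + \<parallel>x'\<parallel>\<^sup>2 / 2\<close> loses exactly
  \<open>2 \<surd>\<mu> \<parallel>x'\<parallel>\<^sup>2\<close> per unit of time and is bounded below, so on late unit time intervals it hardly
  changes. On such an interval the particle hardly moves; its velocity is small at two separated
  instants, so its mean acceleration between them is small, and by the equation of motion so is
  the gradient, which is nearly constant there
  (\<open>friction_finds_small_velocity_and_gradient\<close>). At such an instant \<open>T\<^sub>0\<close> the small gradient
  gives \<open>f - inf f < \<alpha>/2\<close> and the small velocity gives \<open>\<parallel>x'\<parallel>\<^sup>2 / 2 < \<alpha>/2\<close>. Since \<open>E\<close> decreases,
  \<open>f(x) \<le> E < inf f + \<alpha>\<close> from then on: the trajectory is trapped in the sublevel set.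

  Inside the sublevel set the energy
  \<open>\<Lambda> = f(x) - inf f + \<parallel>x' + \<surd>\<mu> (x - \<pi>(x))\<parallel>\<^sup>2 / 2\<close> satisfies \<open>\<Lambda>' \<le> - \<surd>\<mu> \<Lambda>\<close>
  (\<open>aiming_lyapunov_decay\<close>). Besides strong aiming this uses two properties of the derivative of
  the nearest-point projection: its range is orthogonal to \<open>x - \<pi>(x)\<close>
  (\<open>nearest_point_derivative_orthogonal\<close>), and its quadratic form is nonnegative
  (\<open>nearest_point_derivative_nonneg\<close>). Both follow directly from the minimality of the distance.

  Because \<open>\<Lambda>\<close> decays to zero, there is a time \<open>T \<ge> T\<^sub>0\<close> with \<open>\<Lambda>(T) \<le> \<alpha>\<close>, which is below the
  constant \<open>3 \<alpha> / 2 + dist(x(T), M)\<^sup>2\<close> of the claimed bound; and \<open>f(x) - inf f \<le> \<Lambda>\<close> throughout.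
\<close>

section \<open>Derivatives of nearest-point projections\<close>

text \<open>
  Adding the two squared distance inequalities cancels every quadratic term and leaves the inner
  product.
\<close>

lemma nearest_points_monotone:
  fixes x y p q :: "'a::real_inner"
  assumes "dist x p \<le> dist x q" and "dist y q \<le> dist y p"
  shows "(x - y) \<bullet> (p - q) \<ge> 0"
proof -
  have "(x - p) \<bullet> (x - p) \<le> (x - q) \<bullet> (x - q)" "(y - q) \<bullet> (y - q) \<le> (y - p) \<bullet> (y - p)"
    using assms by (simp_all add: dist_norm norm_le)
  then show ?thesis
    by (simp add: inner_diff inner_commute)
qed

text \<open>
  Restrict to the line \<open>s \<mapsto> x + s h\<close>. The points \<open>\<pi>(x + s h)\<close> compete with \<open>\<pi>(x)\<close> for being
  closest to \<open>x\<close>, so their squared distance to \<open>x\<close> is minimal at \<open>s = 0\<close> and its derivative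
  vanishes: this is the orthogonality. Nonnegativity is the infinitesimal form of the monotonicity
  of nearest points; it reflects that \<open>\<pi>\<close> is the gradient of the convex function
  \<open>(\<parallel>x\<parallel>\<^sup>2 - dist(x, S)\<^sup>2) / 2\<close>.
\<close>

lemma
  fixes \<pi> :: "'a::real_inner \<Rightarrow> 'a"
  assumes U: "open U" "x \<in> U"
    and in_S: "\<And>y. y \<in> U \<Longrightarrow> \<pi> y \<in> S"
    and nearest: "\<And>y z. y \<in> U \<Longrightarrow> z \<in> S \<Longrightarrow> dist y (\<pi> y) \<le> dist y z"
    and D: "(\<pi> has_derivative D) (at x)"
  shows nearest_point_derivative_orthogonal: "(x - \<pi> x) \<bullet> D h = 0"
    and nearest_point_derivative_nonneg: "h \<bullet> D h \<ge> 0"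
proof -
  have line: "((\<lambda>s::real. \<pi> (x + s *\<^sub>R h)) has_derivative (\<lambda>s. s *\<^sub>R D h)) (at 0)"
  proof -
    have "((\<lambda>s::real. x + s *\<^sub>R h) has_derivative (\<lambda>s. s *\<^sub>R h)) (at 0)"
      by (auto intro!: derivative_eq_intros)
    from has_derivative_compose[OF this, of \<pi> D] D
    show ?thesis
      using has_derivative_linear[OF D] by (simp add: linear_scale)
  qed
  have "open ((\<lambda>s::real. x + s *\<^sub>R h) -` U)"
    by (intro open_vimage U continuous_intros)
  moreover have "0 \<in> (\<lambda>s::real. x + s *\<^sub>R h) -` U"
    using U(2) by simp
  ultimately obtain d where "d > 0" and d: "\<And>s. \<bar>s\<bar> < d \<Longrightarrow> x + s *\<^sub>R h \<in> U"
    by (metis (lifting) open_dist vimageE dist_real_def diff_zero)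
  show "(x - \<pi> x) \<bullet> D h = 0"
  proof -
    let ?\<chi> = "\<lambda>s::real. (x - \<pi> (x + s *\<^sub>R h)) \<bullet> (x - \<pi> (x + s *\<^sub>R h))"
    have "(?\<chi> has_real_derivative - 2 * ((x - \<pi> x) \<bullet> D h)) (at 0)"
      unfolding has_field_derivative_def
      by (auto intro!: derivative_eq_intros line simp: algebra_simps inner_commute fun_eq_iff)
    moreover have "?\<chi> 0 \<le> ?\<chi> s" if "\<bar>0 - s\<bar> < d" for s
      using nearest[OF U(2) in_S[OF d[of s]]] that by (simp add: dist_norm norm_le)
    ultimately have "- 2 * ((x - \<pi> x) \<bullet> D h) = 0"
      using \<open>d > 0\<close> by (intro DERIV_local_min[where d = d and f = ?\<chi>]) auto
    then show ?thesis by simp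
  qed
  show "h \<bullet> D h \<ge> 0"
  proof (rule ccontr)
    let ?\<psi> = "\<lambda>s::real. h \<bullet> \<pi> (x + s *\<^sub>R h)"
    assume "\<not> h \<bullet> D h \<ge> 0"
    moreover have "(?\<psi> has_real_derivative h \<bullet> D h) (at 0)"
      unfolding has_field_derivative_def
      by (auto intro!: derivative_eq_intros line simp: algebra_simps fun_eq_iff)
    ultimately obtain e where "e > 0" and e: "\<And>s. s > 0 \<Longrightarrow> s < e \<Longrightarrow> ?\<psi> (0 + s) < ?\<psi> 0"
      using DERIV_neg_dec_right[of ?\<psi> "h \<bullet> D h" 0] by (auto simp: not_le)
    define s where "s = min d e / 2"
    have s: "s > 0" "s < e" "\<bar>s\<bar> < d"
      using \<open>d > 0\<close> \<open>e > 0\<close> by (auto simp: s_def)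
    have "((x + s *\<^sub>R h) - x) \<bullet> (\<pi> (x + s *\<^sub>R h) - \<pi> x) \<ge> 0"
      using U(2) d[OF s(3)] by (intro nearest_points_monotone nearest in_S)
    then have "s * (?\<psi> s - ?\<psi> 0) \<ge> 0"
      by (simp add: inner_diff_right right_diff_distrib)
    with e[OF s(1,2)] s(1) show False
      by (simp add: zero_le_mult_iff)
  qed
qed

section \<open>Dissipation of the mechanical energy\<close>

lemma antimono_from_right_derivative_nonpos:
  fixes F :: "real \<Rightarrow> real"
  assumes deriv: "\<And>t. t \<ge> a \<Longrightarrow> (F has_real_derivative F' t) (at t within {a..})"
    and nonpos: "\<And>t. t \<ge> a \<Longrightarrow> F' t \<le> 0"
    and "a \<le> s" "s \<le> t"
  shows "F t \<le> F s"
proof (rule DERIV_nonpos_imp_decreasing_open[OF \<open>s \<le> t\<close>])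
  fix r assume r: "s < r" "r < t"
  then have "at r within {a..} = at r"
    using \<open>a \<le> s\<close> by (intro at_within_interior) auto
  then show "\<exists>y. (F has_real_derivative y) (at r) \<and> y \<le> 0"
    using deriv[of r] nonpos[of r] r \<open>a \<le> s\<close> by auto
next
  have "continuous_on {a..} F"
    by (rule DERIV_continuous_on[OF deriv]) auto
  then show "continuous_on {s..t} F"
    using \<open>a \<le> s\<close> by (rule_tac continuous_on_subset) auto
qed

lemma gradient_chain:
  fixes x :: "real \<Rightarrow> 'a::real_inner"
  assumes "GDERIV f (x t) :> D" and "(x has_vector_derivative x') (at t within S)"
  shows "((\<lambda>t. f (x t)) has_real_derivative D \<bullet> x') (at t within S)"
  using has_derivative_compose[OF assms(2)[unfolded has_vector_derivative_def] assms(1)[unfolded gderiv_def]]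
  unfolding has_field_derivative_def by (simp add: mult.commute[of "D \<bullet> x'"] inner_commute[of D] mult_commute_abs)

lemma half_norm_square_derivative:
  fixes w :: "real \<Rightarrow> 'a::real_inner"
  assumes "(w has_vector_derivative w') (at t within S)"
  shows "((\<lambda>t. norm (w t) ^ 2 / 2) has_real_derivative w t \<bullet> w') (at t within S)"
proof -
  have "((\<lambda>t. w t \<bullet> w t) has_real_derivative 2 * (w t \<bullet> w')) (at t within S)"
    unfolding has_field_derivative_def
    by (auto intro!: derivative_eq_intros assms[unfolded has_vector_derivative_def]
        simp: fun_eq_iff inner_commute)
  from DERIV_cdivide[OF this, of 2] show ?thesis
    by (simp add: power2_norm_eq_inner)
qed

lemma friction_energy_derivative:
  fixes x v a :: "real \<Rightarrow> 'a::real_inner"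
  assumes f: "GDERIV f (x t) :> g (x t)"
    and x: "(x has_vector_derivative v t) (at t within S)"
    and v: "(v has_vector_derivative a t) (at t within S)"
    and ode: "a t + c *\<^sub>R v t = - g (x t)"
  shows "((\<lambda>t. f (x t) + norm (v t) ^ 2 / 2) has_real_derivative - c * norm (v t) ^ 2) (at t within S)"
proof -
  have "a t = - g (x t) - c *\<^sub>R v t"
    using ode by (simp add: eq_diff_eq)
  then have "g (x t) \<bullet> v t + v t \<bullet> a t = - c * norm (v t) ^ 2"
    by (simp add: inner_diff_right inner_commute power2_norm_eq_inner)
  then show ?thesis
    using DERIV_add[OF gradient_chain[of f, OF f x] half_norm_square_derivative[OF v]] by simp
qed

text \<open>
  Since \<open>E\<close> is nonincreasing and bounded below, some unit interval costs at most \<open>c \<eta>\<^sup>2\<close> of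
  energy. There \<open>x\<close> moves by at most \<open>\<eta>\<close>, hence the gradient along the path changes by at most
  \<open>L \<eta>\<close>. The mean value theorem on the first and the last third yields instants \<open>s\<close> and \<open>t\<close>, at
  least \<open>1/3\<close> apart, with velocities at most \<open>2 \<eta>\<close>. Integrating the equation of motion between them
  shows that the gradient at \<open>s\<close> is of order \<open>\<eta>\<close>.
\<close>

lemma friction_finds_small_velocity_and_gradient:
  fixes x v a :: "real \<Rightarrow> 'a::real_inner"
  assumes f: "\<And>z. GDERIV f z :> g z"
    and bdd: "\<And>z. m \<le> f z"
    and x: "\<And>t. t \<ge> 0 \<Longrightarrow> (x has_vector_derivative v t) (at t within {0..})"
    and v: "\<And>t. t \<ge> 0 \<Longrightarrow> (v has_vector_derivative a t) (at t within {0..})"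
    and ode: "\<And>t. t \<ge> 0 \<Longrightarrow> a t + c *\<^sub>R v t = - g (x t)"
    and "c > 0" and "L \<ge> 0"
    and lip: "\<And>s t. s \<ge> 0 \<Longrightarrow> t \<ge> 0 \<Longrightarrow> norm (g (x s) - g (x t)) \<le> L * norm (x s - x t)"
    and "\<epsilon> > 0"
  obtains t where "t \<ge> 0" "norm (v t) < \<epsilon>" "norm (g (x t)) < \<epsilon>"
proof -
  define E where "E t = f (x t) + norm (v t) ^ 2 / 2" for t
  have E_deriv: "(E has_real_derivative - c * norm (v t) ^ 2) (at t within {0..})" if "t \<ge> 0" for t
    unfolding E_def using that by (intro friction_energy_derivative[where a = a and g = g] f x v ode)
  have E_antimono: "E t \<le> E s" if "0 \<le> s" "s \<le> t" for s t
    using that \<open>c > 0\<close> by (intro antimono_from_right_derivative_nonpos[OF E_deriv]) auto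
  have E_at: "(E has_real_derivative - c * norm (v t) ^ 2) (at t)" if "t > 0" for t
    using E_deriv[of t] that by (simp add: at_within_interior[of t "{0..}"])

  \<comment> \<open>\<open>3 * (L + 4 + c)\<close> is the constant in the final gradient estimate; the summand 1 makes
      it strict.\<close>
  define K where "K = 3 * (L + 4 + c) + 1"
  have "K > 0"
    using \<open>c > 0\<close> \<open>L \<ge> 0\<close> by (simp add: K_def)
  define \<eta> where "\<eta> = \<epsilon> / K"
  have "\<eta> > 0"
    using \<open>\<epsilon> > 0\<close> \<open>K > 0\<close> by (simp add: \<eta>_def)
  obtain n :: nat where n: "E n - E (Suc n) \<le> c * \<eta>\<^sup>2"
  proof -
    have "m \<le> E (real i)" for i
      using bdd[of "x (real i)"] by (simp add: E_def add_increasing2)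
    moreover have "decseq (\<lambda>i. E (real i))"
      by (auto simp: decseq_def intro: E_antimono)
    ultimately obtain l where "(\<lambda>i. E (real i)) \<longlonglongrightarrow> l"
      using decseq_convergent by metis
    then have "(\<lambda>i. E (real i) - E (real (Suc i))) \<longlonglongrightarrow> l - l"
      by (intro tendsto_diff LIMSEQ_Suc)
    moreover have "c * \<eta>\<^sup>2 > l - l"
      using \<open>c > 0\<close> \<open>\<eta> > 0\<close> by simp
    ultimately have "\<forall>\<^sub>F i in sequentially. E (real i) - E (real (Suc i)) < c * \<eta>\<^sup>2"
      by (rule order_tendstoD(2))
    then show thesis
      using that by (auto simp: eventually_sequentially intro: less_imp_le)
  qed
  have drop: "E s - E t \<le> c * \<eta>\<^sup>2" if "real n \<le> s" "s \<le> t" "t \<le> real n + 1" for s t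
    using E_antimono[of "real n" s] E_antimono[of t "real (Suc n)"] n that by simp

  have short: "norm (x t - x s) \<le> \<eta>" if st: "real n \<le> s" "s < t" "t \<le> real n + 1" for s t
  proof -
    \<comment> \<open>Young's inequality \<open>\<parallel>v\<parallel> \<le> (\<eta> + \<parallel>v\<parallel>\<^sup>2 / \<eta>) / 2\<close> bounds the speed by the derivative of a
        function of time and energy, so the path length is paid for by the energy drop.\<close>
    let ?\<phi> = "\<lambda>r. (\<eta> * r - E r / (c * \<eta>)) / 2"
    let ?\<phi>' = "\<lambda>r. (\<eta> + norm (v r) ^ 2 / \<eta>) / 2"
    have sub: "{s..t} \<subseteq> {0..}" using st by auto
    have "norm (x t - x s) \<le> ?\<phi> t - ?\<phi> s"
    proof (rule differentiable_bound_general[where f' = v and \<phi>' = ?\<phi>'])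
      show "continuous_on {s..t} x"
        by (rule continuous_on_subset[OF continuous_on_vector_derivative[OF x] sub]) auto
      show "continuous_on {s..t} ?\<phi>"
        using \<open>c > 0\<close> \<open>\<eta> > 0\<close>
        by (intro continuous_intros continuous_on_subset[OF DERIV_continuous_on[OF E_deriv] sub]) auto
    next
      fix r assume r: "s < r" "r < t"
      then have "r > 0" using st by auto
      then show "(x has_vector_derivative v r) (at r)"
        using x[of r] by (simp add: at_within_interior[of r "{0..}"])
      show "(?\<phi> has_vector_derivative ?\<phi>' r) (at r)"
        unfolding has_real_derivative_iff_has_vector_derivative[symmetric]
        using \<open>c > 0\<close> \<open>\<eta> > 0\<close>
        by (auto intro!: derivative_eq_intros E_at[OF \<open>r > 0\<close>] simp: field_simps)
      have "0 \<le> (norm (v r) - \<eta>)\<^sup>2" by simp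
      then show "norm (v r) \<le> ?\<phi>' r"
        using \<open>\<eta> > 0\<close> by (simp add: field_simps power2_eq_square)
    qed (use st in auto)
    also have "\<dots> = (\<eta> * (t - s) + (E s - E t) / (c * \<eta>)) / 2"
      by (simp add: algebra_simps diff_divide_distrib)
    also have "\<dots> \<le> (\<eta> * 1 + (c * \<eta>\<^sup>2) / (c * \<eta>)) / 2"
      using st \<open>c > 0\<close> \<open>\<eta> > 0\<close> drop[of s t]
      by (intro divide_right_mono add_mono mult_left_mono) auto
    also have "\<dots> = \<eta>"
      using \<open>c > 0\<close> \<open>\<eta> > 0\<close> by (simp add: power2_eq_square)
    finally show ?thesis .
  qed

  have slow: "\<exists>r. s < r \<and> r < s + 1/3 \<and> norm (v r) \<le> 2 * \<eta>"
    if s: "real n \<le> s" "s + 1/3 \<le> real n + 1" for s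
  proof -
    have "continuous_on {s..s + 1/3} E"
      using s by (intro continuous_on_subset[OF DERIV_continuous_on[OF E_deriv]]) auto
    moreover have "E differentiable (at r)" if "s < r" for r
      using E_at[of r] that s by (auto simp: real_differentiable_def)
    ultimately obtain l r where r: "s < r" "r < s + 1/3" "(E has_real_derivative l) (at r)"
        "E (s + 1/3) - E s = (s + 1/3 - s) * l"
      using MVT[of s "s + 1/3" E] by auto
    have "l = - c * norm (v r) ^ 2"
      using r E_at[of r] s by (intro DERIV_unique[OF r(3)]) auto
    then have "c * norm (v r) ^ 2 \<le> c * (3 * \<eta>\<^sup>2)"
      using r(4) drop[of s "s + 1/3"] s by (simp add: field_simps)
    then have "norm (v r) ^ 2 \<le> 3 * \<eta>\<^sup>2"
      using \<open>c > 0\<close> by (rule mult_left_le_imp_le)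
    then have "norm (v r) ^ 2 \<le> (2 * \<eta>)\<^sup>2"
      by (rule order_trans) (simp add: power_mult_distrib)
    then have "norm (v r) \<le> 2 * \<eta>"
      by (rule power2_le_imp_le) (use \<open>\<eta> > 0\<close> in simp)
    with r show ?thesis by blast
  qed
  obtain s where s: "real n < s" "s < real n + 1/3" "norm (v s) \<le> 2 * \<eta>"
    using slow[of "real n"] by auto
  obtain t where t: "real n + 2/3 < t" "t < real n + 1" "norm (v t) \<le> 2 * \<eta>"
    using slow[of "real n + 2/3"] by auto
  define G where "G = g (x s)"
  \<comment> \<open>If the gradient were constantly \<open>G\<close>, the equation \<open>(v + c x)' = - G\<close> would make \<open>h\<close> constant;
      the true \<open>h'\<close> is the deviation \<open>G - g (x r)\<close>.\<close>
  define h where "h r = v r + c *\<^sub>R x r + r *\<^sub>R G" for r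
  have "norm (h t - h s) \<le> (L * \<eta>) * norm (t - s)"
  proof (rule differentiable_bound)
    fix r assume r: "r \<in> {s..t}"
    then have "r \<ge> 0" using s by auto
    have "(h has_vector_derivative a r + c *\<^sub>R v r + G) (at r within {0..})"
      unfolding h_def by (auto intro!: derivative_eq_intros x v \<open>r \<ge> 0\<close>)
    then have "(h has_vector_derivative G - g (x r)) (at r within {s..t})"
      using s ode[OF \<open>r \<ge> 0\<close>] by (auto intro: has_vector_derivative_within_subset)
    then show "(h has_derivative (\<lambda>d. d *\<^sub>R (G - g (x r)))) (at r within {s..t})"
      by (simp add: has_vector_derivative_def)
    have "norm (x s - x r) \<le> \<eta>"
      using short[of s r] r s t \<open>\<eta> > 0\<close> by (cases "r = s") (auto simp: norm_minus_commute)
    then have "norm (G - g (x r)) \<le> L * \<eta>"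
      using lip[of s r] \<open>r \<ge> 0\<close> s \<open>L \<ge> 0\<close> unfolding G_def
      by (smt (verit) mult_left_mono of_nat_0_le_iff)
    then show "onorm (\<lambda>d. d *\<^sub>R (G - g (x r))) \<le> L * \<eta>"
      by (intro onorm_le) (simp add: mult.commute mult_left_mono)
  qed (use s t in auto)
  also have "\<dots> \<le> (L * \<eta>) * 1"
    using s t \<open>L \<ge> 0\<close> \<open>\<eta> > 0\<close> by (intro mult_left_mono) auto
  finally have h: "norm (h t - h s) \<le> L * \<eta>" by simp
  have "(t - s) *\<^sub>R G = (h t - h s) - v t + v s - c *\<^sub>R (x t - x s)"
    by (simp add: h_def algebra_simps)
  then have "norm ((t - s) *\<^sub>R G) \<le> norm (h t - h s) + norm (v t) + norm (v s) + norm (c *\<^sub>R (x t - x s))"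
    by (smt (verit) norm_triangle_ineq norm_triangle_ineq4)
  also have "\<dots> \<le> L * \<eta> + 2 * \<eta> + 2 * \<eta> + c * \<eta>"
    using h s t \<open>c > 0\<close> short[of s t] by (intro add_mono) auto
  finally have "(t - s) * norm G \<le> (L + 4 + c) * \<eta>"
    using s t by (simp add: distrib_right)
  moreover have "1/3 * norm G \<le> (t - s) * norm G"
    using s t by (intro mult_right_mono) auto
  ultimately have "norm G \<le> (3 * (L + 4 + c)) * \<eta>"
    by (simp add: algebra_simps)
  also have "\<dots> < K * \<eta>"
    using \<open>\<eta> > 0\<close> by (simp add: K_def)
  finally have "norm G < \<epsilon>"
    using \<open>K > 0\<close> by (simp add: \<eta>_def)
  moreover have "norm (v s) < \<epsilon>"
  proof -
    have "2 * \<eta> < K * \<eta>"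
      using \<open>\<eta> > 0\<close> \<open>c > 0\<close> \<open>L \<ge> 0\<close> by (simp add: K_def)
    then show ?thesis
      using s(3) \<open>K > 0\<close> by (simp add: \<eta>_def)
  qed
  ultimately show thesis
    using that[of s] s by (simp add: G_def)
qed

section \<open>Exponential decay under strong aiming\<close>

text \<open>
  Write \<open>k = \<surd>\<mu>\<close>, \<open>y = x - \<pi>(x)\<close> and \<open>w = D\<pi>(x) v\<close>. Inserting the equation of motion, the terms
  \<open>g \<bullet> v\<close> cancel and orthogonality removes \<open>y \<bullet> w\<close>, so that
  \<open>\<Lambda>' = - k (g \<bullet> y + \<parallel>v\<parallel>\<^sup>2 + k y \<bullet> v + v \<bullet> w)\<close>. Strong aiming bounds \<open>g \<bullet> y\<close> from below by
  \<open>f - m + k\<^sup>2 \<parallel>y\<parallel>\<^sup>2 / 2\<close>, and the bracket then dominates \<open>\<Lambda> + \<parallel>v\<parallel>\<^sup>2 / 2 + v \<bullet> w \<ge> \<Lambda>\<close>.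
  The decay rate follows because \<open>\<Lambda> exp(k t)\<close> is nonincreasing.
\<close>

lemma aiming_lyapunov_decay:
  fixes x v a :: "real \<Rightarrow> 'a::real_inner" and D :: "'a \<Rightarrow> 'a \<Rightarrow> 'a"
  assumes "\<mu> > 0"
    and f: "\<And>z. GDERIV f z :> g z"
    and x: "\<And>t. t \<ge> T \<Longrightarrow> (x has_vector_derivative v t) (at t within {T..})"
    and v: "\<And>t. t \<ge> T \<Longrightarrow> (v has_vector_derivative a t) (at t within {T..})"
    and ode: "\<And>t. t \<ge> T \<Longrightarrow> a t + (2 * sqrt \<mu>) *\<^sub>R v t = - g (x t)"
    and in_U: "\<And>t. t \<ge> T \<Longrightarrow> x t \<in> U"
    and \<pi>: "\<And>y. y \<in> U \<Longrightarrow> (\<pi> has_derivative D y) (at y)"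
    and ortho: "\<And>y h. y \<in> U \<Longrightarrow> (y - \<pi> y) \<bullet> D y h = 0"
    and nonneg: "\<And>y h. y \<in> U \<Longrightarrow> h \<bullet> D y h \<ge> 0"
    and f_proj: "\<And>y. y \<in> U \<Longrightarrow> f (\<pi> y) = m"
    and aiming: "strong_aiming \<mu> f g \<pi> U"
    and "T \<le> s" "s \<le> t"
  defines "\<Lambda> \<equiv> \<lambda>t. f (x t) - m + norm (v t + sqrt \<mu> *\<^sub>R (x t - \<pi> (x t))) ^ 2 / 2"
  shows "\<Lambda> t \<le> \<Lambda> s * exp (sqrt \<mu> * (s - t))"
proof -
  define k where "k = sqrt \<mu>"
  have "k > 0" "k * k = \<mu>"
    using \<open>\<mu> > 0\<close> by (simp_all add: k_def)
  define \<Lambda>' where "\<Lambda>' t = g (x t) \<bullet> v t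
    + (v t + k *\<^sub>R (x t - \<pi> (x t))) \<bullet> (a t + k *\<^sub>R (v t - D (x t) (v t)))" for t
  have deriv: "(\<Lambda> has_real_derivative \<Lambda>' t) (at t within {T..})" if "t \<ge> T" for t
  proof -
    have "((\<lambda>t. \<pi> (x t)) has_vector_derivative D (x t) (v t)) (at t within {T..})"
      using has_derivative_compose[OF x[OF that, unfolded has_vector_derivative_def] \<pi>[OF in_U[OF that]]]
        has_derivative_linear[OF \<pi>[OF in_U[OF that]]]
      by (simp add: has_vector_derivative_def linear_scale)
    then have "((\<lambda>t. v t + k *\<^sub>R (x t - \<pi> (x t))) has_vector_derivative
        a t + k *\<^sub>R (v t - D (x t) (v t))) (at t within {T..})"
      by (auto intro!: derivative_eq_intros x[OF that] v[OF that])
    from DERIV_add[OF DERIV_diff[OF gradient_chain[of f, OF f x[OF that]] DERIV_const]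
        half_norm_square_derivative[OF this]]
    show ?thesis
      by (simp add: \<Lambda>_def \<Lambda>'_def k_def)
  qed
  have decay: "\<Lambda>' t \<le> - k * \<Lambda> t" if "t \<ge> T" for t
  proof -
    define y where "y = x t - \<pi> (x t)"
    define w where "w = D (x t) (v t)"
    have a: "a t = - g (x t) - (2 * k) *\<^sub>R v t"
      using ode[OF that] by (simp add: eq_diff_eq k_def)
    have "y \<bullet> w = 0" "v t \<bullet> w \<ge> 0"
      using ortho nonneg in_U[OF that] by (auto simp: y_def w_def)
    have aim: "g (x t) \<bullet> y \<ge> f (x t) - m + k * k / 2 * (y \<bullet> y)"
      using aiming in_U[OF that] f_proj[OF in_U[OF that]] \<open>k * k = \<mu>\<close>
      by (auto simp: strong_aiming_def y_def power2_norm_eq_inner)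
    have "\<Lambda>' t = - k * (g (x t) \<bullet> y + v t \<bullet> v t + k * (y \<bullet> v t) + v t \<bullet> w)"
      using \<open>y \<bullet> w = 0\<close>
      by (simp add: \<Lambda>'_def a y_def[symmetric] w_def[symmetric] algebra_simps inner_commute)
    also have "\<dots> \<le> - k * (f (x t) - m + k * k / 2 * (y \<bullet> y) + v t \<bullet> v t / 2 + k * (y \<bullet> v t))"
      using aim \<open>v t \<bullet> w \<ge> 0\<close> \<open>k > 0\<close> inner_ge_zero[of "v t"]
      by (intro mult_left_mono_neg) linarith+
    also have "\<dots> = - k * \<Lambda> t"
      unfolding \<Lambda>_def k_def[symmetric] y_def[symmetric] power2_norm_eq_inner
      by (simp add: algebra_simps inner_commute add_divide_distrib diff_divide_distrib)
    finally show ?thesis .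
  qed
  have "\<Lambda> t * exp (k * t) \<le> \<Lambda> s * exp (k * s)"
  proof (rule antimono_from_right_derivative_nonpos[where F = "\<lambda>t. \<Lambda> t * exp (k * t)"
        and F' = "\<lambda>t. (\<Lambda>' t + k * \<Lambda> t) * exp (k * t)" and a = T])
    fix t assume "t \<ge> T"
    then show "((\<lambda>t. \<Lambda> t * exp (k * t)) has_real_derivative (\<Lambda>' t + k * \<Lambda> t) * exp (k * t)) (at t within {T..})"
      by (auto intro!: derivative_eq_intros deriv simp: algebra_simps)
    show "(\<Lambda>' t + k * \<Lambda> t) * exp (k * t) \<le> 0"
      using decay[OF \<open>t \<ge> T\<close>] by (simp add: mult_le_0_iff)
  qed fact+
  then show ?thesis
    unfolding k_def[symmetric] by (simp add: right_diff_distrib exp_diff field_simps)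
qed

section \<open>Convergence of the heavy ball dynamics\<close>

theorem theorem8:
  fixes f :: "real ^ 'd \<Rightarrow> real" and gradf :: "real ^ 'd \<Rightarrow> real ^ 'd"
    and k :: nat and \<alpha> \<mu> :: real
    and x0 :: "real ^ 'd" and x :: "real \<Rightarrow> real ^ 'd"
  assumes bounded_below: "bdd_below (range f)"
    and gradient: "\<And>z. GDERIV f z :> gradf z"
    and C1: "continuous_on UNIV gradf"
    and locally_Lipschitz: "local_lipschitz (UNIV :: real set) UNIV (\<lambda>_. gradf)"
    and nonempty: "minimizers f \<noteq> {}"
    and submanifold: "C2_submanifold k (minimizers f)"
    and codim: "k < CARD('d)"
    and \<alpha>: "\<alpha> > 0"
    and closest: "unique_closest_points (minimizers f) (sublevel f \<alpha>)"
    and proj_C1: "C1_on (closest_point (minimizers f)) (sublevel f \<alpha>)"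
    and \<mu>: "\<mu> > 0"
    and aiming: "strong_aiming \<mu> f gradf (closest_point (minimizers f)) (sublevel f \<alpha>)"
    and Lipschitz_sublevel:
      "\<And>R. R > (INF z. f z) \<Longrightarrow> \<exists>L>0. L-lipschitz_on {z. f z < R} gradf"
    and small_gradient:
      "\<exists>\<delta>>0. \<forall>z. norm (gradf z) ^ 2 < \<delta> \<longrightarrow> f z - (INF z. f z) < \<alpha> / 2"
    and solution: "heavy_ball_solution \<mu> gradf x0 x"
  shows "\<exists>T\<ge>0. (\<forall>t\<ge>T. x t \<in> sublevel f \<alpha>) \<and>
    (\<forall>t>T. f (x t) - (INF z. f z)
       \<le> (3 * \<alpha> / 2 + infdist (x T) (minimizers f) ^ 2) * exp (sqrt \<mu> * (T - t)))"
proof -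
  define m where "m = (INF z. f z)"
  define M where "M = minimizers f"
  define U where "U = sublevel f \<alpha>"
  define \<pi> where "\<pi> = closest_point M"
  have m: "m \<le> f z" for z
    unfolding m_def using bounded_below by (intro cINF_lower) auto
  have U: "z \<in> U \<longleftrightarrow> f z < m + \<alpha>" for z
    by (simp add: U_def sublevel_def m_def)
  have "continuous_on UNIV f"
    using gradient unfolding gderiv_def
    by (intro continuous_at_imp_continuous_on ballI has_derivative_continuous)
  then have "open U"
    unfolding U_def sublevel_def by (intro open_Collect_less continuous_intros)
  have nearest: "\<pi> y \<in> M \<and> (\<forall>z\<in>M. dist y (\<pi> y) \<le> dist y z)" if "y \<in> U" for y
  proof -
    have "\<exists>p. p \<in> M \<and> (\<forall>z\<in>M. dist y p \<le> dist y z)"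
      using closest that unfolding unique_closest_points_def M_def U_def by blast
    from someI_ex[OF this] show ?thesis
      unfolding \<pi>_def closest_point_def .
  qed
  obtain D where D: "(\<pi> has_derivative blinfun_apply (D y)) (at y)" if "y \<in> U" for y
    using proj_C1 unfolding C1_on_def M_def[symmetric] U_def[symmetric] \<pi>_def[symmetric] by blast
  obtain v a where
      x: "\<And>t. t \<ge> 0 \<Longrightarrow> (x has_vector_derivative v t) (at t within {0..})"
    and v: "\<And>t. t \<ge> 0 \<Longrightarrow> (v has_vector_derivative a t) (at t within {0..})"
    and ode: "\<And>t. t \<ge> 0 \<Longrightarrow> a t + (2 * sqrt \<mu>) *\<^sub>R v t = - gradf (x t)"
    and init: "x 0 = x0" "v 0 = 0"
    using solution unfolding heavy_ball_solution_def by blast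
  define E where "E t = f (x t) + norm (v t) ^ 2 / 2" for t
  have E_antimono: "E t \<le> E s" if "0 \<le> s" "s \<le> t" for s t
  proof (rule antimono_from_right_derivative_nonpos[OF _ _ that])
    fix r :: real assume "r \<ge> 0"
    then show "(E has_real_derivative - (2 * sqrt \<mu>) * norm (v r) ^ 2) (at r within {0..})"
      unfolding E_def by (intro friction_energy_derivative[where a = a and g = gradf] gradient x v ode)
  qed (use \<mu> in auto)
  have f_le_E: "f (x t) \<le> E t" for t
    by (simp add: E_def)

  \<comment> \<open>The energy bound keeps the trajectory in \<open>{z. f z \<le> f x0}\<close>; adding 1 makes the sublevel set
      strict and its level larger than the infimum.\<close>
  obtain L where "L > 0" and L: "L-lipschitz_on {z. f z < f x0 + 1} gradf"
    using Lipschitz_sublevel[of "f x0 + 1"] m[of x0] by (auto simp: m_def)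
  have lip: "norm (gradf (x s) - gradf (x t)) \<le> L * norm (x s - x t)" if "s \<ge> 0" "t \<ge> 0" for s t
  proof -
    have "f (x r) < f x0 + 1" if "r \<ge> 0" for r
      using f_le_E[of r] E_antimono[of 0 r] E_def[of 0] that init by simp
    then show ?thesis
      using lipschitz_onD[OF L, of "x s" "x t"] that by (simp add: dist_norm)
  qed
  obtain \<delta> where "\<delta> > 0" and \<delta>: "\<And>z. norm (gradf z) ^ 2 < \<delta> \<Longrightarrow> f z < m + \<alpha> / 2"
    using small_gradient by (force simp: m_def)
  obtain T0 where "T0 \<ge> 0" and T0: "norm (v T0) < min (sqrt \<delta>) (sqrt \<alpha>)"
      "norm (gradf (x T0)) < min (sqrt \<delta>) (sqrt \<alpha>)"
    using friction_finds_small_velocity_and_gradient[of f gradf m x v a "2 * sqrt \<mu>" L "min (sqrt \<delta>) (sqrt \<alpha>)"]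
      gradient m x v ode lip \<mu> \<alpha> \<open>L > 0\<close> \<open>\<delta> > 0\<close> by auto
  have "norm (gradf (x T0)) ^ 2 < \<delta>" "norm (v T0) ^ 2 < \<alpha>"
    using power_strict_mono[of "norm (gradf (x T0))" "sqrt \<delta>" 2] power_strict_mono[of "norm (v T0)" "sqrt \<alpha>" 2]
      T0 \<open>\<delta> > 0\<close> \<alpha> by simp_all
  then have "E T0 < m + \<alpha>"
    using \<delta>[of "x T0"] by (simp add: E_def)
  then have stay: "x t \<in> U" if "t \<ge> T0" for t
    using f_le_E[of t] E_antimono[OF \<open>T0 \<ge> 0\<close> that] by (simp add: U)

  define \<Lambda> where "\<Lambda> t = f (x t) - m + norm (v t + sqrt \<mu> *\<^sub>R (x t - \<pi> (x t))) ^ 2 / 2" for t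
  have decay: "\<Lambda> t \<le> \<Lambda> s * exp (sqrt \<mu> * (s - t))" if "T0 \<le> s" "s \<le> t" for s t
    unfolding \<Lambda>_def
  proof (rule aiming_lyapunov_decay[where T = T0 and g = gradf and U = U and a = a
        and D = "\<lambda>y. blinfun_apply (D y)"])
    show "strong_aiming \<mu> f gradf \<pi> U"
      using aiming by (simp add: \<pi>_def M_def U_def)
  next
    fix t assume "T0 \<le> t"
    then show "(x has_vector_derivative v t) (at t within {T0..})"
      "(v has_vector_derivative a t) (at t within {T0..})"
      "a t + (2 * sqrt \<mu>) *\<^sub>R v t = - gradf (x t)"
      using \<open>T0 \<ge> 0\<close>
      by (auto intro: has_vector_derivative_within_subset[OF x] has_vector_derivative_within_subset[OF v] ode)
  next
    fix y h assume y: "y \<in> U"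
    show "(y - \<pi> y) \<bullet> D y h = 0"
      by (rule nearest_point_derivative_orthogonal[OF \<open>open U\<close> y _ _ D[OF y], where S = M])
         (use nearest in auto)
    show "h \<bullet> D y h \<ge> 0"
      by (rule nearest_point_derivative_nonneg[OF \<open>open U\<close> y _ _ D[OF y], where S = M])
         (use nearest in auto)
  next
    fix y assume "y \<in> U"
    then show "f (\<pi> y) = m"
      using nearest[of y] by (simp add: M_def minimizers_def m_def)
  qed (use \<mu> gradient stay D that in auto)

  have "\<Lambda> T0 \<ge> 0"
    using m by (simp add: \<Lambda>_def)
  \<comment> \<open>This waiting time brings \<open>\<Lambda>\<close> below \<open>\<alpha>\<close>, because \<open>u exp(- u) \<le> 1\<close> for
      \<open>u = \<Lambda> T0 / \<alpha>\<close>.\<close>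
  define T where "T = T0 + \<Lambda> T0 / (\<alpha> * sqrt \<mu>)"
  have "T \<ge> T0"
    using \<open>\<Lambda> T0 \<ge> 0\<close> \<alpha> \<mu> by (simp add: T_def)
  have "\<Lambda> T \<le> \<alpha>"
  proof -
    have "\<Lambda> T0 / \<alpha> \<le> exp (\<Lambda> T0 / \<alpha>)"
      using exp_ge_add_one_self[of "\<Lambda> T0 / \<alpha>"] by linarith
    then have "\<Lambda> T0 * exp (- (\<Lambda> T0 / \<alpha>)) \<le> \<alpha>"
      using \<alpha> by (simp add: exp_minus field_simps)
    moreover have "sqrt \<mu> * (T0 - T) = - (\<Lambda> T0 / \<alpha>)"
      using \<alpha> \<mu> by (simp add: T_def)
    ultimately show ?thesis
      using decay[of T0 T] \<open>T \<ge> T0\<close> by simp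
  qed
  have "f (x t) - m \<le> (3 * \<alpha> / 2 + infdist (x T) M ^ 2) * exp (sqrt \<mu> * (T - t))" if "t > T" for t
  proof -
    have "f (x t) - m \<le> \<Lambda> t"
      by (simp add: \<Lambda>_def)
    also have "\<dots> \<le> \<Lambda> T * exp (sqrt \<mu> * (T - t))"
      using that \<open>T \<ge> T0\<close> by (intro decay) auto
    also have "\<dots> \<le> (3 * \<alpha> / 2 + infdist (x T) M ^ 2) * exp (sqrt \<mu> * (T - t))"
    proof (intro mult_right_mono)
      show "\<Lambda> T \<le> 3 * \<alpha> / 2 + infdist (x T) M ^ 2"
        using \<open>\<Lambda> T \<le> \<alpha>\<close> \<alpha> zero_le_power2[of "infdist (x T) M"] by linarith
    qed simp
    finally show ?thesis .
  qed
  then show ?thesis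
    using stay \<open>T \<ge> T0\<close> \<open>T0 \<ge> 0\<close> unfolding m_def M_def U_def
    by (intro exI[of _ T]) auto
qed

end
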